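(* Let $n\ge1$. There exists an $\alpha\in\hat{\Psi}$ such that $dS_{n+1}(f_\alpha)$ is isometric to $\mathbb{R}\times S^n$ with metric $$g=\beta(t)\,dt\otimes dt+a(t)^2\,\Omega_n,$$ where $a,\beta:\mathbb{R}\rightarrow\mathbb{R}$ are smooth functions for which (i) $a(t)$ is a positive constant for $t\le0$ and an increasing function for $t>0$; (ii) $\displaystyle\lim_{t\to\infty}a(t)=\infty$; (iii) $\beta(t)<0$ for all $t$; (iv) $\displaystyle\lim_{t\to\infty}\beta(t)=-1$.
   Context: $\mathbb{R}^{n+2}_1$ is $\mathbb{R}^{n+2}$ with metric $\eta=-dx^0\otimes dx^0+dx^1\otimes dx^1+\cdots+dx^{n+1}\otimes dx^{n+1}$. For a smooth function $f:(a,b)\to\mathbb{R}$ on an open interval (possibly unbounded), $dS_{n+1}(f)$ is the hypersurface $\{x\in\mathbb{R}^{n+2}_1 : x^0\in(a,b),\ -(x^0)^2+(x^1)^2+\cdots+(x^{n+1})^2=f(x^0)^2\}$ with the metric induced from $\eta$. $\Psi$ is the set of smooth functions $\alpha:\mathbb{R}\to\mathbb{R}$ with $\alpha(t)>0$ for all $t$ and such that $h(t):=\alpha(t)\sinh t$ has nonzero derivative for all $t$. $\hat{\Psi}$ is the set of $\alpha\in\Psi$ with $|\alpha'(t)|\neq\alpha(t)$ for all $t$. For $\alpha\in\Psi$, $f_\alpha:=\alpha\circ h^{-1}$ on the open interval $h(\mathbb{R})$. $\Omega_n$ denotes the round metric on the unit sphere $S^n$, and also its pullback to $\mathbb{R}\times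 S^n$ under the projection to $S^n$; $t$ is the coordinate on $\mathbb{R}$. *)

theory Defs
  imports "HOL-Analysis.Analysis"
begin

subsection \<open>Smooth maps\<close>

text \<open>
  The predicates \<open>higher_differentiable_on\<close> and \<open>smooth_on\<close> are meant for open sets \<open>S\<close>.
  On a finite-dimensional space, differentiability together with \<open>C^k\<close> regularity of
  \<open>x \<mapsto> Df(x) v\<close> for each fixed \<open>v\<close> is \<open>C^(k+1)\<close> regularity of \<open>f\<close>.
\<close>

primrec higher_differentiable_on ::
  "'a::real_normed_vector set \<Rightarrow> ('a \<Rightarrow> 'b::real_normed_vector) \<Rightarrow> nat \<Rightarrow> bool" where
  "higher_differentiable_on S f 0 \<longleftrightarrow> continuous_on S f"
| "higher_differentiable_on S f (Suc k) \<longleftrightarrow>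
     (\<forall>x\<in>S. f differentiable (at x)) \<and>
     (\<forall>v. higher_differentiable_on S (\<lambda>x. frechet_derivative f (at x) v) k)"

definition smooth_on :: "'a::real_normed_vector set \<Rightarrow> ('a \<Rightarrow> 'b::real_normed_vector) \<Rightarrow> bool" where
  "smooth_on S f \<longleftrightarrow> (\<forall>k. higher_differentiable_on S f k)"

subsection \<open>Submanifolds of a Euclidean space and isometries between them\<close>

text \<open>
  Manifolds are embedded submanifolds \<open>M\<close> of a Euclidean space, represented by their point
  sets.  Maps between them are smooth if they extend locally to smooth maps of the ambient
  spaces; tangent vectors are velocities of smooth curves in \<open>M\<close>.
\<close>

definition smooth_map ::
  "'a::euclidean_space set \<Rightarrow> 'b::euclidean_space set \<Rightarrow> ('a \<Rightarrow> 'b) \<Rightarrow> bool" where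
  "smooth_map M N F \<longleftrightarrow> F ` M \<subseteq> N \<and>
     (\<forall>p\<in>M. \<exists>U G. open U \<and> p \<in> U \<and> smooth_on U G \<and> (\<forall>x\<in>M \<inter> U. G x = F x))"

definition diffeomorphism ::
  "'a::euclidean_space set \<Rightarrow> 'b::euclidean_space set \<Rightarrow> ('a \<Rightarrow> 'b) \<Rightarrow> bool" where
  "diffeomorphism M N F \<longleftrightarrow>
     bij_betw F M N \<and> smooth_map M N F \<and> smooth_map N M (inv_into M F)"

definition curves_with_velocity ::
  "'a::euclidean_space set \<Rightarrow> 'a \<Rightarrow> 'a \<Rightarrow> (real \<Rightarrow> 'a) set" where
  "curves_with_velocity M p v =
     {c. (\<exists>e>0. smooth_on {-e<..<e} c \<and> c ` {-e<..<e} \<subseteq> M) \<and>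
         c 0 = p \<and> (c has_vector_derivative v) (at 0)}"

definition tangent_space :: "'a::euclidean_space set \<Rightarrow> 'a \<Rightarrow> 'a set" where
  "tangent_space M p = {v. curves_with_velocity M p v \<noteq> {}}"

definition differential ::
  "'a::euclidean_space set \<Rightarrow> ('a \<Rightarrow> 'b::euclidean_space) \<Rightarrow> 'a \<Rightarrow> 'a \<Rightarrow> 'b" where
  "differential M F p v =
     (THE w. \<forall>c\<in>curves_with_velocity M p v. ((F \<circ> c) has_vector_derivative w) (at 0))"

text \<open>
  A metric on \<open>M\<close> is given by a function \<open>g\<close> taking a point and two vectors of the ambient
  space; only its values at points of \<open>M\<close> on vectors tangent to \<open>M\<close> matter.
\<close>

type_synonym 'a metric_tensor = "'a \<Rightarrow> 'a \<Rightarrow> 'a \<Rightarrow> real"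

definition isometry ::
  "'a::euclidean_space set \<Rightarrow> 'a metric_tensor \<Rightarrow>
   'b::euclidean_space set \<Rightarrow> 'b metric_tensor \<Rightarrow> ('a \<Rightarrow> 'b) \<Rightarrow> bool" where
  "isometry M g N g' F \<longleftrightarrow> diffeomorphism M N F \<and>
     (\<forall>p\<in>M. \<forall>v\<in>tangent_space M p. \<forall>w\<in>tangent_space M p.
        g' (F p) (differential M F p v) (differential M F p w) = g p v w)"

definition isometric ::
  "'a::euclidean_space set \<Rightarrow> 'a metric_tensor \<Rightarrow>
   'b::euclidean_space set \<Rightarrow> 'b metric_tensor \<Rightarrow> bool" where
  "isometric M g N g' \<longleftrightarrow> (\<exists>F. isometry M g N g' F)"

subsection \<open>The hypersurfaces in Minkowski space\<close>

text \<open>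
  Minkowski space of dimension \<open>n + 2\<close> is \<^typ>\<open>real \<times> (real ^ 'm)\<close> with \<open>CARD('m) = n + 1\<close>: the
  first component is the time coordinate \<open>x^0\<close>, the second one is \<open>(x^1, ..., x^(n+1))\<close>.
\<close>

definition eta :: "real \<times> (real ^ 'm) \<Rightarrow> real \<times> (real ^ 'm) \<Rightarrow> real" where
  "eta v w = - (fst v * fst w) + (\<Sum>i\<in>UNIV. snd v $ i * snd w $ i)"

definition minkowski_metric :: "(real \<times> (real ^ 'm)) metric_tensor" where
  "minkowski_metric p v w = eta v w"

definition dS :: "real set \<Rightarrow> (real \<Rightarrow> real) \<Rightarrow> (real \<times> (real ^ 'm)) set" where
  "dS I f = {x. fst x \<in> I \<and> - (fst x)\<^sup>2 + (\<Sum>i\<in>UNIV. (snd x $ i)\<^sup>2) = (f (fst x))\<^sup>2}"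

definition h_fun :: "(real \<Rightarrow> real) \<Rightarrow> real \<Rightarrow> real" where
  "h_fun \<alpha> t = \<alpha> t * sinh t"

definition Psi :: "(real \<Rightarrow> real) set" where
  "Psi = {\<alpha>. smooth_on UNIV \<alpha> \<and> (\<forall>t. \<alpha> t > 0) \<and> (\<forall>t. deriv (h_fun \<alpha>) t \<noteq> 0)}"

definition Psi_hat :: "(real \<Rightarrow> real) set" where
  "Psi_hat = {\<alpha> \<in> Psi. \<forall>t. \<bar>deriv \<alpha> t\<bar> \<noteq> \<alpha> t}"

text \<open>
  For \<open>\<alpha>\<close> in \<^const>\<open>Psi\<close> the function \<^term>\<open>h_fun \<alpha>\<close> is injective, so \<open>inv\<close> is its genuine
  inverse on \<^term>\<open>range (h_fun \<alpha>)\<close>; outside this interval \<open>f_fun \<alpha>\<close> is irrelevant.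
\<close>

definition f_fun :: "(real \<Rightarrow> real) \<Rightarrow> real \<Rightarrow> real" where
  "f_fun \<alpha> = \<alpha> \<circ> inv (h_fun \<alpha>)"

subsection \<open>The product of the line and the sphere\<close>

definition cylinder :: "(real \<times> (real ^ 'm)) set" where
  "cylinder = UNIV \<times> sphere 0 1"

definition round_metric :: "(real ^ 'm) metric_tensor" where
  "round_metric u v w = v \<bullet> w"

definition warped_metric ::
  "(real \<Rightarrow> real) \<Rightarrow> (real \<Rightarrow> real) \<Rightarrow> (real \<times> (real ^ 'm)) metric_tensor" where
  "warped_metric \<beta> a p v w =
     \<beta> (fst p) * (fst v * fst w) + (a (fst p))\<^sup>2 * round_metric (snd p) (snd v) (snd w)"

end

theory Submission
  imports Defs "HOL-Real_Asymp.Real_Asymp" "HOL-Computational_Algebra.Polynomial"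
begin

text \<open>
  The hypersurface is swept out by the map \<open>(t, u) \<mapsto> (\<alpha>(t) sinh t, \<alpha>(t) cosh t u)\<close> with \<open>u\<close> in the
  unit sphere, because \<open>\<alpha>\<^sup>2 cosh\<^sup>2 - \<alpha>\<^sup>2 sinh\<^sup>2 = \<alpha>\<^sup>2\<close> and \<open>h(t) = \<alpha>(t) sinh t\<close> is a valid time
  coordinate. Pulling the Minkowski metric back along it gives
  \<open>((\<alpha> cosh)'\<^sup>2 - (\<alpha> sinh)'\<^sup>2) dt\<^sup>2 + (\<alpha> cosh)\<^sup>2 \<Omega> = (\<alpha>'\<^sup>2 - \<alpha>\<^sup>2) dt\<^sup>2 + (\<alpha> cosh)\<^sup>2 \<Omega>\<close>.
  This is \<open>dS_isometric_warped_cylinder\<close>, valid for every \<open>\<alpha>\<close> in \<^const>\<open>Psi\<close>; the problem is thereby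
  reduced to choosing one function \<open>\<alpha>\<close>, with \<open>a = \<alpha> cosh\<close> and \<open>\<beta> = \<alpha>'\<^sup>2 - \<alpha>\<^sup>2\<close>.

  The radius \<open>a\<close> is constant where \<open>\<alpha> = 1 / cosh\<close>, while \<open>\<alpha> = 1\<close> is de Sitter space, with \<open>\<beta> = -1\<close>
  and \<open>a = cosh\<close>. The smooth function \<open>w(t) = exp(-1/t)\<close> for \<open>t > 0\<close>, extended by \<open>0\<close>, joins the two:
  \<open>\<alpha> = w + (1 - w) / cosh\<close>. Then \<open>a = 1 + w (cosh - 1)\<close>, which has the required monotonicity and
  growth, and \<open>\<alpha> \<rightarrow> 1\<close>, \<open>\<alpha>' \<rightarrow> 0\<close> give \<open>\<beta> \<rightarrow> -1\<close>. The sign conditions follow from the single inequality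
  \<open>|\<alpha>'| < \<alpha>\<close> (\<open>abs_deriv_sech_to_one_less\<close>): it says that \<open>\<beta> < 0\<close>, and it implies membership in
  \<^const>\<open>Psi_hat\<close> (\<open>Psi_hatI\<close>). It holds because \<open>w' = w / t\<^sup>2\<close> and \<open>cosh t - 1 \<le> t\<^sup>2 cosh t\<close>, so that the
  contribution of \<open>w'\<close> to \<open>\<alpha>'\<close> never exceeds \<open>w\<close>.

  Smoothness of the inverse of \<open>h\<close>, and of the elementary functions involved, comes from one
  bootstrapping principle, \<open>smooth_on_autonomous_ode\<close>.
\<close>

section \<open>Calculus of smooth maps\<close>

lemma higher_differentiable_on_cong:
  assumes "open S" "\<And>x. x \<in> S \<Longrightarrow> f x = g x" "higher_differentiable_on S f k"
  shows "higher_differentiable_on S g k"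
  using assms(2,3)
proof (induction k arbitrary: f g)
  case 0
  then show ?case using continuous_on_cong by force
next
  case (Suc k)
  have "g differentiable at x" if "x \<in> S" for x
    using Suc.prems that assms(1) has_derivative_transform_within_open
    unfolding differentiable_def higher_differentiable_on.simps by metis
  moreover have "frechet_derivative f (at x) = frechet_derivative g (at x)" if "x \<in> S" for x
    using frechet_derivative_transform_within_open[OF _ assms(1) that] Suc.prems that by auto
  ultimately show ?case
    using Suc.prems Suc.IH[of "\<lambda>x. frechet_derivative f (at x) _" "\<lambda>x. frechet_derivative g (at x) _"]
    by auto
qed

text \<open>
  The defining clause speaks of \<^const>\<open>frechet_derivative\<close>; this introduction rule accepts a
  derivative in any closed form, which then only has to be known on \<open>S\<close>.
\<close>

lemma higher_differentiable_on_SucI: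
  assumes "open S" "\<And>x. x \<in> S \<Longrightarrow> (f has_derivative f' x) (at x)"
    and "\<And>v. higher_differentiable_on S (\<lambda>x. f' x v) k"
  shows "higher_differentiable_on S f (Suc k)"
proof -
  have eq: "f' x = frechet_derivative f (at x)" if "x \<in> S" for x
    using frechet_derivative_at assms(2)[OF that] .
  have "higher_differentiable_on S (\<lambda>x. frechet_derivative f (at x) v) k" for v
    using assms(1) _ assms(3)[of v] by (rule higher_differentiable_on_cong) (simp add: eq)
  then show ?thesis
    using assms(2) by (auto simp: differentiable_def)
qed

lemma higher_differentiable_on_SucD:
  assumes "higher_differentiable_on S f (Suc k)"
  shows "x \<in> S \<Longrightarrow> (f has_derivative frechet_derivative f (at x)) (at x)"
    and "higher_differentiable_on S (\<lambda>x. frechet_derivative f (at x) v) k"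
  using assms by (auto simp: frechet_derivative_works[symmetric])

lemma higher_differentiable_on_imp_lower:
  "higher_differentiable_on S f (Suc k) \<Longrightarrow> higher_differentiable_on S f k"
proof (induction k arbitrary: f)
  case 0
  then show ?case
    by (auto intro!: differentiable_imp_continuous_on
        simp: differentiable_on_def differentiable_at_withinI)
next
  case (Suc k)
  then show ?case
    by (simp only: higher_differentiable_on.simps(2)) blast
qed

lemma higher_differentiable_on_const:
  "open S \<Longrightarrow> higher_differentiable_on S (\<lambda>x. c) k"
proof (induction k arbitrary: c)
  case (Suc k)
  show ?case
    by (rule higher_differentiable_on_SucI[where f' = "\<lambda>x v. 0"]) (use Suc in auto)
qed auto

lemma higher_differentiable_on_bounded_linear:
  assumes "open S" "bounded_linear L" "higher_differentiable_on S f k"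
  shows "higher_differentiable_on S (\<lambda>x. L (f x)) k"
  using assms(3)
proof (induction k arbitrary: f)
  case 0
  then show ?case
    using bounded_linear.continuous_on[OF assms(2)] by simp
next
  case (Suc k)
  show ?case
    using assms(1)
  proof (rule higher_differentiable_on_SucI)
    show "((\<lambda>x. L (f x)) has_derivative (\<lambda>v. L (frechet_derivative f (at x) v))) (at x)"
      if "x \<in> S" for x
      using bounded_linear.has_derivative[OF assms(2) higher_differentiable_on_SucD(1)[OF Suc.prems that]] .
    show "higher_differentiable_on S (\<lambda>x. L (frechet_derivative f (at x) v)) k" for v
      by (rule Suc.IH[OF higher_differentiable_on_SucD(2)[OF Suc.prems]])
  qed
qed

lemma higher_differentiable_on_add:
  assumes "open S" "higher_differentiable_on S f k" "higher_differentiable_on S g k"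
  shows "higher_differentiable_on S (\<lambda>x. f x + g x) k"
  using assms(2,3)
proof (induction k arbitrary: f g)
  case 0
  then show ?case by (simp add: continuous_on_add)
next
  case (Suc k)
  note D = higher_differentiable_on_SucD
  show ?case
    using assms(1) has_derivative_add[OF D(1)[OF Suc.prems(1)] D(1)[OF Suc.prems(2)]]
  proof (rule higher_differentiable_on_SucI)
    fix v
    show "higher_differentiable_on S
      (\<lambda>x. frechet_derivative f (at x) v + frechet_derivative g (at x) v) k"
      by (intro Suc.IH D(2) Suc.prems)
  qed
qed

lemma higher_differentiable_on_sum:
  assumes "open S" "\<And>i. i \<in> I \<Longrightarrow> higher_differentiable_on S (f i) k"
  shows "higher_differentiable_on S (\<lambda>x. \<Sum>i\<in>I. f i x) k"
  using assms(2)
  by (induction I rule: infinite_finite_induct)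
    (simp_all add: higher_differentiable_on_const higher_differentiable_on_add assms(1))

lemma higher_differentiable_on_bilinear:
  assumes "open S" "bounded_bilinear B"
    and "higher_differentiable_on S f k" "higher_differentiable_on S g k"
  shows "higher_differentiable_on S (\<lambda>x. B (f x) (g x)) k"
  using assms(3,4)
proof (induction k arbitrary: f g)
  case 0
  then show ?case
    using bounded_bilinear.continuous_on[OF assms(2)] by simp
next
  case (Suc k)
  note D = higher_differentiable_on_SucD
  note lower = higher_differentiable_on_imp_lower
  show ?case
    using assms(1) bounded_bilinear.FDERIV[OF assms(2) D(1)[OF Suc.prems(1)] D(1)[OF Suc.prems(2)]]
  proof (rule higher_differentiable_on_SucI)
    fix v
    show "higher_differentiable_on S (\<lambda>x. B (f x) (frechet_derivative g (at x) v) +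
      B (frechet_derivative f (at x) v) (g x)) k"
      by (intro higher_differentiable_on_add assms(1) Suc.IH
          D(2)[OF Suc.prems(1)] D(2)[OF Suc.prems(2)] lower[OF Suc.prems(1)] lower[OF Suc.prems(2)])
  qed
qed

text \<open>
  The argument of \<open>Df\<close> in the chain rule \<open>D(f \<circ> g)(x) v = Df(g x) (Dg(x) v)\<close> varies with \<open>x\<close>, but
  regularity of \<open>Df\<close> is only known along fixed vectors. Expanding \<open>Dg(x) v\<close> in the standard basis
  turns the right-hand side into a sum of products to which the induction hypothesis applies.
\<close>

lemma higher_differentiable_on_compose:
  fixes g :: "'a::real_normed_vector \<Rightarrow> 'b::euclidean_space"
    and f :: "'b \<Rightarrow> 'c::real_normed_vector"
  assumes "open S" "open T" "g ` S \<subseteq> T"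
    and "higher_differentiable_on T f k" "higher_differentiable_on S g k"
  shows "higher_differentiable_on S (\<lambda>x. f (g x)) k"
  using assms(4,5)
proof (induction k arbitrary: f)
  case 0
  then show ?case
    using assms(3) by (auto intro: continuous_on_compose2)
next
  case (Suc k)
  note D = higher_differentiable_on_SucD
  let ?Df = "\<lambda>y. frechet_derivative f (at y)" and ?Dg = "\<lambda>x. frechet_derivative g (at x)"
  have der: "((\<lambda>x. f (g x)) has_derivative (\<lambda>v. \<Sum>b\<in>Basis. (?Dg x v \<bullet> b) *\<^sub>R ?Df (g x) b)) (at x)"
    if "x \<in> S" for x
  proof -
    have f: "(f has_derivative ?Df (g x)) (at (g x))"
      using D(1)[OF Suc.prems(1)] assms(3) that by blast
    have g: "(g has_derivative ?Dg x) (at x)"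
      using D(1)[OF Suc.prems(2) that] .
    have "?Df (g x) w = (\<Sum>b\<in>Basis. (w \<bullet> b) *\<^sub>R ?Df (g x) b)" for w
    proof -
      have "linear (?Df (g x))"
        using f has_derivative_linear by blast
      then have "?Df (g x) (\<Sum>b\<in>Basis. (w \<bullet> b) *\<^sub>R b) = (\<Sum>b\<in>Basis. (w \<bullet> b) *\<^sub>R ?Df (g x) b)"
        by (simp add: linear_sum linear_scale)
      then show ?thesis
        by (simp add: euclidean_representation)
    qed
    then have "(\<lambda>v. ?Df (g x) (?Dg x v)) = (\<lambda>v. \<Sum>b\<in>Basis. (?Dg x v \<bullet> b) *\<^sub>R ?Df (g x) b)"
      by blast
    then show ?thesis
      using has_derivative_compose[OF g f] by simp
  qed
  show ?case
    using assms(1) der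
  proof (rule higher_differentiable_on_SucI)
    fix v
    have "higher_differentiable_on S (\<lambda>x. ?Dg x v \<bullet> b) k" for b
      by (rule higher_differentiable_on_bounded_linear[OF assms(1) bounded_linear_inner_left
            D(2)[OF Suc.prems(2)]])
    moreover have "higher_differentiable_on S (\<lambda>x. ?Df (g x) b) k" for b
      by (rule Suc.IH[OF D(2)[OF Suc.prems(1)] higher_differentiable_on_imp_lower[OF Suc.prems(2)]])
    ultimately show "higher_differentiable_on S (\<lambda>x. \<Sum>b\<in>Basis. (?Dg x v \<bullet> b) *\<^sub>R ?Df (g x) b) k"
      by (intro higher_differentiable_on_sum assms(1)
          higher_differentiable_on_bilinear[OF assms(1) bounded_bilinear_scaleR])
  qed
qed

lemma higher_differentiable_on_real_SucI:
  fixes f :: "real \<Rightarrow> real"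
  assumes "open S" "\<And>x. x \<in> S \<Longrightarrow> (f has_real_derivative f' x) (at x)"
    and "higher_differentiable_on S f' k"
  shows "higher_differentiable_on S f (Suc k)"
proof (rule higher_differentiable_on_SucI)
  show "(f has_derivative (\<lambda>v. f' x * v)) (at x)" if "x \<in> S" for x
    using assms(2)[OF that] by (simp add: has_field_derivative_def)
  show "higher_differentiable_on S (\<lambda>x. f' x * v) k" for v
    using higher_differentiable_on_bounded_linear[OF assms(1) bounded_linear_mult_left assms(3)] .
qed (rule assms(1))

lemma smooth_on_const: "open S \<Longrightarrow> smooth_on S (\<lambda>x. c)"
  by (simp add: smooth_on_def higher_differentiable_on_const)

lemma smooth_on_bounded_linear:
  "open S \<Longrightarrow> bounded_linear L \<Longrightarrow> smooth_on S f \<Longrightarrow> smooth_on S (\<lambda>x. L (f x))"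
  by (simp add: smooth_on_def higher_differentiable_on_bounded_linear)

lemma smooth_on_add:
  "open S \<Longrightarrow> smooth_on S f \<Longrightarrow> smooth_on S g \<Longrightarrow> smooth_on S (\<lambda>x. f x + g x)"
  by (simp add: smooth_on_def higher_differentiable_on_add)

lemma smooth_on_scaleR:
  "open S \<Longrightarrow> smooth_on S f \<Longrightarrow> smooth_on S g \<Longrightarrow> smooth_on S (\<lambda>x. f x *\<^sub>R g x)"
  by (simp add: smooth_on_def higher_differentiable_on_bilinear[OF _ bounded_bilinear_scaleR])

lemma smooth_on_mult:
  fixes f g :: "'a::real_normed_vector \<Rightarrow> real"
  shows "open S \<Longrightarrow> smooth_on S f \<Longrightarrow> smooth_on S g \<Longrightarrow> smooth_on S (\<lambda>x. f x * g x)"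
  using smooth_on_scaleR[of S f g] by simp

lemma smooth_on_minus:
  fixes f :: "'a::real_normed_vector \<Rightarrow> 'b::real_normed_vector"
  shows "open S \<Longrightarrow> smooth_on S f \<Longrightarrow> smooth_on S (\<lambda>x. - f x)"
  by (rule smooth_on_bounded_linear[OF _ bounded_linear_minus[OF bounded_linear_ident]])

lemma smooth_on_diff:
  fixes f g :: "'a::real_normed_vector \<Rightarrow> 'b::real_normed_vector"
  shows "open S \<Longrightarrow> smooth_on S f \<Longrightarrow> smooth_on S g \<Longrightarrow> smooth_on S (\<lambda>x. f x - g x)"
  using smooth_on_add[OF _ _ smooth_on_minus, of S f g] by simp

lemma smooth_on_Pair:
  fixes f :: "'a::real_normed_vector \<Rightarrow> 'b::real_normed_vector"
    and g :: "'a::real_normed_vector \<Rightarrow> 'c::real_normed_vector"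
  assumes "open S" "smooth_on S f" "smooth_on S g"
  shows "smooth_on S (\<lambda>x. (f x, g x))"
proof -
  have "bounded_linear (\<lambda>y::'b. (y, 0::'c))" "bounded_linear (\<lambda>z::'c. (0::'b, z))"
    by (intro bounded_linear_Pair bounded_linear_ident bounded_linear_zero)+
  then show ?thesis
    using smooth_on_add[OF assms(1) smooth_on_bounded_linear[OF assms(1) _ assms(2)]
        smooth_on_bounded_linear[OF assms(1) _ assms(3)]] by force
qed

lemma smooth_on_compose:
  fixes g :: "'a::real_normed_vector \<Rightarrow> 'b::euclidean_space"
  shows "smooth_on T f \<Longrightarrow> smooth_on S g \<Longrightarrow> open S \<Longrightarrow> open T \<Longrightarrow> g ` S \<subseteq> T
    \<Longrightarrow> smooth_on S (\<lambda>x. f (g x))"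
  by (simp add: smooth_on_def higher_differentiable_on_compose[of S T g f])

lemma higher_differentiable_on_ident:
  "open S \<Longrightarrow> higher_differentiable_on S (\<lambda>x. x) k"
  by (cases k) (auto intro!: higher_differentiable_on_SucI[where f' = "\<lambda>x v. v"] higher_differentiable_on_const
      simp del: higher_differentiable_on.simps(2))

lemma smooth_on_ident: "open S \<Longrightarrow> smooth_on S (\<lambda>x. x)"
  by (simp add: smooth_on_def higher_differentiable_on_ident)

lemma smooth_on_fst: "open S \<Longrightarrow> smooth_on S fst"
  and smooth_on_snd: "open S \<Longrightarrow> smooth_on S snd"
  by (simp_all add: smooth_on_bounded_linear[OF _ bounded_linear_fst smooth_on_ident]
      smooth_on_bounded_linear[OF _ bounded_linear_snd smooth_on_ident])

lemma smooth_on_imp_continuous_on: "smooth_on S f \<Longrightarrow> continuous_on S f"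
  unfolding smooth_on_def by (drule spec[of _ 0]) simp

lemma smooth_on_imp_has_derivative:
  "smooth_on S f \<Longrightarrow> x \<in> S \<Longrightarrow> (f has_derivative frechet_derivative f (at x)) (at x)"
  unfolding smooth_on_def by (rule higher_differentiable_on_SucD(1)[of S f 0]) blast+

lemma smooth_on_imp_DERIV:
  fixes f :: "real \<Rightarrow> real"
  shows "smooth_on S f \<Longrightarrow> x \<in> S \<Longrightarrow> (f has_real_derivative deriv f x) (at x)"
  unfolding DERIV_deriv_iff_real_differentiable differentiable_def
  by (rule exI, rule smooth_on_imp_has_derivative)

lemma smooth_on_deriv:
  fixes f :: "real \<Rightarrow> real"
  assumes "open S" "smooth_on S f"
  shows "smooth_on S (deriv f)"
  unfolding smooth_on_def
proof
  fix k
  have "frechet_derivative f (at x) 1 = deriv f x" if "x \<in> S" for x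
    using frechet_derivative_at[OF smooth_on_imp_DERIV[OF assms(2) that, unfolded has_field_derivative_def]]
    by (metis mult.right_neutral)
  moreover have "higher_differentiable_on S (\<lambda>x. frechet_derivative f (at x) 1) k"
    using assms(2)[unfolded smooth_on_def, THEN spec, of "Suc k"]
    by (rule higher_differentiable_on_SucD(2))
  ultimately show "higher_differentiable_on S (deriv f) k"
    using higher_differentiable_on_cong[OF assms(1), of "\<lambda>x. frechet_derivative f (at x) 1"] by simp
qed

text \<open>
  Bootstrapping: once \<open>f\<close> is of class \<open>C\<^sup>k\<close>, so is \<open>f' = G \<circ> f\<close>, and \<open>f\<close> is of class \<open>C\<^sup>k\<^sup>+\<^sup>1\<close>. Reciprocals, the exponential function and inverse functions all solve
  equations of this form.
\<close>

lemma smooth_on_autonomous_ode: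
  fixes f G :: "real \<Rightarrow> real"
  assumes "open S" "open T" "f ` S \<subseteq> T" "smooth_on T G"
    and der: "\<And>x. x \<in> S \<Longrightarrow> (f has_real_derivative G (f x)) (at x)"
  shows "smooth_on S f"
  unfolding smooth_on_def
proof
  fix k
  show "higher_differentiable_on S f k"
  proof (induction k)
    case 0
    show ?case
      using DERIV_isCont[OF der] by (simp add: continuous_at_imp_continuous_on)
  next
    case (Suc k)
    have "higher_differentiable_on S (\<lambda>x. G (f x)) k"
      using assms(4) Suc unfolding smooth_on_def
      by (intro higher_differentiable_on_compose[OF assms(1-3), of G]) (erule spec)
    with assms(1) der show ?case
      by (rule higher_differentiable_on_real_SucI[of S f "\<lambda>x. G (f x)"])
  qed
qed

lemma smooth_on_inverse: "smooth_on (- {0}) (inverse :: real \<Rightarrow> real)"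
proof (rule smooth_on_autonomous_ode[where T = UNIV and G = "\<lambda>y. - (y * y)"])
  show "smooth_on UNIV (\<lambda>y::real. - (y * y))"
    by (intro smooth_on_minus smooth_on_mult smooth_on_ident open_UNIV)
  show "(inverse has_real_derivative - (inverse x * inverse x)) (at x)" if "x \<in> - {0}" for x :: real
    using DERIV_inverse[of x] that by (simp add: power2_eq_square)
qed auto

lemma smooth_on_exp: "smooth_on UNIV (exp :: real \<Rightarrow> real)"
  by (rule smooth_on_autonomous_ode[where G = "\<lambda>y. y" and T = UNIV])
    (simp_all add: smooth_on_ident)

lemma smooth_on_cosh: "smooth_on UNIV (cosh :: real \<Rightarrow> real)"
  and smooth_on_sinh: "smooth_on UNIV (sinh :: real \<Rightarrow> real)"
proof -
  have exp_minus: "smooth_on UNIV (\<lambda>x::real. exp (- x))"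
    by (rule smooth_on_compose[OF smooth_on_exp smooth_on_minus[OF open_UNIV smooth_on_ident]]) simp_all
  have "smooth_on UNIV (\<lambda>x::real. (1 / 2) *\<^sub>R (exp x + exp (- x)))"
    and "smooth_on UNIV (\<lambda>x::real. (1 / 2) *\<^sub>R (exp x - exp (- x)))"
    by (intro smooth_on_scaleR smooth_on_add smooth_on_diff smooth_on_const
        smooth_on_exp exp_minus open_UNIV)+
  then show "smooth_on UNIV (cosh :: real \<Rightarrow> real)" "smooth_on UNIV (sinh :: real \<Rightarrow> real)"
    by (simp_all add: cosh_def[abs_def] sinh_def[abs_def])
qed

text \<open>
  The inverse \<open>y\<close> of \<open>f\<close> solves the autonomous equation \<open>y' = 1 / f'(y)\<close>.
\<close>

lemma smooth_on_inv:
  fixes f :: "real \<Rightarrow> real"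
  assumes "smooth_on UNIV f" "inj f" "\<And>x. deriv f x \<noteq> 0"
  shows "smooth_on (range f) (inv f)"
proof (rule smooth_on_autonomous_ode[where T = UNIV and G = "\<lambda>t. inverse (deriv f t)"])
  have cont: "continuous_on UNIV f"
    using assms(1) by (rule smooth_on_imp_continuous_on)
  show "open (range f)"
    using injective_into_1d_imp_open_map_UNIV[OF open_UNIV cont assms(2)] by simp
  show "smooth_on UNIV (\<lambda>t. inverse (deriv f t))"
    by (rule smooth_on_compose[OF smooth_on_inverse smooth_on_deriv[OF open_UNIV assms(1)]])
      (use assms(3) in \<open>auto simp: open_Compl\<close>)
  fix y assume "y \<in> range f"
  then obtain x where y: "y = f x" by auto
  have f': "(f has_derivative (*) (deriv f x)) (at x)"
    using smooth_on_imp_DERIV[OF assms(1)] by (simp add: has_field_derivative_def)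
  have "(inv f has_derivative (*) (inverse (deriv f x))) (at (f x))"
    using assms(2,3)
    by (intro has_derivative_inverse_strong[OF open_UNIV UNIV_I cont _ f']) (simp_all add: fun_eq_iff)
  then show "(inv f has_real_derivative inverse (deriv f (inv f y))) (at y)"
    using assms(2) by (simp add: y has_field_derivative_def)
qed auto

section \<open>Tangent vectors and differentials\<close>

lemma has_vector_derivative_compose:
  assumes "(c has_vector_derivative v) (at x)" "(F has_derivative F') (at (c x))"
  shows "((F \<circ> c) has_vector_derivative F' v) (at x)"
proof -
  have "(\<lambda>r. F' (r *\<^sub>R v)) = (\<lambda>r. r *\<^sub>R F' v)"
    using linear_scale[OF has_derivative_linear[OF assms(2)]] by blast
  then show ?thesis
    using has_derivative_compose[OF assms(1)[unfolded has_vector_derivative_def] assms(2)]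
    by (simp add: has_vector_derivative_def o_def)
qed

text \<open>
  By the chain rule, any ambient derivative \<open>F'\<close> of \<open>F\<close> satisfies the description in
  \<^const>\<open>differential\<close>. Tangency of \<open>v\<close> makes that description determine a unique vector, as it
  supplies a curve on which two candidates can be compared.
\<close>

lemma differential_eq:
  assumes "(F has_derivative F') (at p)" "v \<in> tangent_space M p"
  shows "differential M F p v = F' v"
  unfolding differential_def
proof (rule the_equality)
  have push: "((F \<circ> c) has_vector_derivative F' v) (at 0)" if "c \<in> curves_with_velocity M p v" for c
    using that assms(1) unfolding curves_with_velocity_def
    by (intro has_vector_derivative_compose) auto
  then show "\<forall>c\<in>curves_with_velocity M p v. ((F \<circ> c) has_vector_derivative F' v) (at 0)"
    by blast
  fix w
  assume "\<forall>c\<in>curves_with_velocity M p v. ((F \<circ> c) has_vector_derivative w) (at 0)"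
  then show "w = F' v"
    using assms(2) push unfolding tangent_space_def
    by (auto intro: vector_derivative_unique_at)
qed

text \<open>
  Along a curve in \<open>M\<close> with velocity \<open>v\<close>, the sphere component of \<open>F\<close> keeps unit length, and
  differentiating its squared length gives twice the inner product in question.
\<close>

lemma derivative_tangent_to_cylinder:
  fixes F :: "'a::euclidean_space \<Rightarrow> real \<times> (real ^ 'm)"
  assumes "(F has_derivative F') (at p)" "v \<in> tangent_space M p" "F ` M \<subseteq> cylinder"
  shows "snd (F p) \<bullet> snd (F' v) = 0"
proof -
  obtain c e where c: "e > 0" "c ` {-e<..<e} \<subseteq> M" "c 0 = p" "(c has_vector_derivative v) (at 0)"
    using assms(2) unfolding tangent_space_def curves_with_velocity_def by blast
  define q where "q = (\<lambda>s. snd (F (c s)))"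
  have "((\<lambda>s. F (c s)) has_vector_derivative F' v) (at 0)"
    using has_vector_derivative_compose[OF c(4)] assms(1) c(3) by (simp add: o_def)
  then have q: "(q has_derivative (\<lambda>r. r *\<^sub>R snd (F' v))) (at 0)"
    unfolding q_def has_vector_derivative_def using has_derivative_snd by fastforce
  have 1: "((\<lambda>s. q s \<bullet> q s) has_derivative
      (\<lambda>r. q 0 \<bullet> (r *\<^sub>R snd (F' v)) + (r *\<^sub>R snd (F' v)) \<bullet> q 0)) (at 0)"
    using has_derivative_inner[OF q q] .
  have norm: "q s \<bullet> q s = 1" if "s \<in> {-e<..<e}" for s
  proof -
    have "F (c s) \<in> cylinder"
      using that c(2) assms(3) by blast
    then have "norm (q s) = 1"
      unfolding q_def cylinder_def by auto
    then show ?thesis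
      by (simp add: dot_square_norm)
  qed
  have "((\<lambda>s. q s \<bullet> q s) has_derivative (\<lambda>r. 0)) (at 0)"
    by (rule has_derivative_transform_within_open[where s = "{-e<..<e}" and f = "\<lambda>s. 1"])
      (use norm c(1) in auto)
  from has_derivative_unique[OF 1 this] have "2 * (q 0 \<bullet> snd (F' v)) = 0"
    by (auto simp: fun_eq_iff inner_commute dest: spec[of _ 1])
  then show ?thesis
    by (simp add: q_def c(3))
qed

section \<open>The hypersurface as a warped cylinder\<close>

lemma eta_eq_inner: "eta v w = - (fst v * fst w) + snd v \<bullet> snd w"
  by (simp add: eta_def inner_vec_def)

lemma dS_iff: "x \<in> dS I f \<longleftrightarrow> fst x \<in> I \<and> - (fst x)\<^sup>2 + snd x \<bullet> snd x = (f (fst x))\<^sup>2"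
  by (simp add: dS_def inner_vec_def power2_eq_square)

lemma smooth_on_h_fun:
  assumes "smooth_on UNIV \<alpha>"
  shows "smooth_on UNIV (h_fun \<alpha>)"
  unfolding h_fun_def[abs_def]
  by (intro smooth_on_mult assms smooth_on_sinh open_UNIV)

lemma DERIV_h_fun:
  assumes "smooth_on UNIV \<alpha>"
  shows "(h_fun \<alpha> has_real_derivative deriv \<alpha> t * sinh t + \<alpha> t * cosh t) (at t)"
  unfolding h_fun_def[abs_def]
  by (auto intro!: derivative_eq_intros smooth_on_imp_DERIV[OF assms])

lemma Psi_inj:
  assumes "\<alpha> \<in> Psi"
  shows "inj (h_fun \<alpha>)"
proof (rule linorder_injI)
  fix x y :: real
  assume "x < y"
  have smooth: "smooth_on UNIV (h_fun \<alpha>)"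
    using assms by (simp add: Psi_def smooth_on_h_fun)
  show "h_fun \<alpha> x \<noteq> h_fun \<alpha> y"
  proof
    assume "h_fun \<alpha> x = h_fun \<alpha> y"
    then obtain z where "(h_fun \<alpha> has_real_derivative 0) (at z)"
      using Rolle[OF \<open>x < y\<close>] continuous_on_subset[OF smooth_on_imp_continuous_on[OF smooth]]
        smooth_on_imp_DERIV[OF smooth] real_differentiable_def by (metis UNIV_I subset_UNIV)
    then show False
      using assms DERIV_imp_deriv by (fastforce simp: Psi_def)
  qed
qed

lemma abs_sinh_less_cosh: "\<bar>sinh t\<bar> < cosh (t::real)"
  using sinh_less_cosh_real[of t] sinh_less_cosh_real[of "-t"] by auto

text \<open>
  As \<open>h' = \<alpha>' sinh + \<alpha> cosh\<close> and \<open>|sinh| < cosh\<close>, the bound on \<open>\<alpha>'\<close> forces \<open>h' > 0\<close> as well.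
\<close>

lemma Psi_hatI:
  assumes "smooth_on UNIV \<alpha>" "\<And>t. \<bar>deriv \<alpha> t\<bar> < \<alpha> t"
  shows "\<alpha> \<in> Psi_hat"
proof -
  have pos: "\<alpha> t > 0" for t
    using assms(2)[of t] by linarith
  have "deriv (h_fun \<alpha>) t \<noteq> 0" for t
  proof -
    have "(h_fun \<alpha> has_real_derivative deriv \<alpha> t * sinh t + \<alpha> t * cosh t) (at t)"
      by (rule DERIV_h_fun[OF assms(1)])
    then have "deriv (h_fun \<alpha>) t = deriv \<alpha> t * sinh t + \<alpha> t * cosh t"
      by (rule DERIV_imp_deriv)
    moreover have "\<bar>deriv \<alpha> t * sinh t\<bar> < \<alpha> t * cosh t"
      unfolding abs_mult by (intro mult_strict_mono assms(2) pos abs_sinh_less_cosh) auto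
    ultimately show ?thesis
      by auto
  qed
  then show ?thesis
    using assms(1) pos assms(2) by (auto simp: Psi_hat_def Psi_def less_imp_neq)
qed

text \<open>
  The parametrization \<open>\<Phi>(t, u) = (h t, a(t) u)\<close> with \<open>a = \<alpha> cosh\<close> makes sense for all vectors \<open>u\<close>, and
  as a map of the ambient spaces it has the smooth inverse \<open>F\<close> on the open set \<open>U\<close>. Rescaling by
  \<open>1 / a(h\<^sup>-\<^sup>1 x\<^sup>0)\<close> instead of by the norm keeps \<open>F\<close> smooth and linear in the space component, and
  agrees with normalization on the hypersurface. To compare the metrics, a tangent vector \<open>v\<close> is
  recovered as \<open>D\<Phi>(DF v)\<close>: for \<open>DF v = (\<tau>, \<omega>)\<close> this is \<open>(h' \<tau>, a' \<tau> u + a \<omega>)\<close>, and the cross terms of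
  the Minkowski product vanish since \<open>\<omega>\<close> is orthogonal to \<open>u\<close>.
\<close>

proposition dS_isometric_warped_cylinder:
  assumes "\<alpha> \<in> Psi"
  shows "isometric (dS (range (h_fun \<alpha>)) (f_fun \<alpha>) :: (real \<times> (real ^ 'm)) set) minkowski_metric
    (cylinder :: (real \<times> (real ^ 'm)) set) (warped_metric (\<lambda>t. (deriv \<alpha> t)\<^sup>2 - (\<alpha> t)\<^sup>2) (\<lambda>t. \<alpha> t * cosh t))"
proof -
  define h where "h = h_fun \<alpha>"
  define a where "a = (\<lambda>t. \<alpha> t * cosh t)"
  define M :: "(real \<times> (real ^ 'm)) set" where "M = dS (range h) (f_fun \<alpha>)"
  define U :: "(real \<times> (real ^ 'm)) set" where "U = range h \<times> UNIV"
  define F :: "real \<times> (real ^ 'm) \<Rightarrow> real \<times> (real ^ 'm)"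
    where "F = (\<lambda>x. (inv h (fst x), inverse (a (inv h (fst x))) *\<^sub>R snd x))"
  define \<Phi> :: "real \<times> (real ^ 'm) \<Rightarrow> real \<times> (real ^ 'm)"
    where "\<Phi> = (\<lambda>z. (h (fst z), a (fst z) *\<^sub>R snd z))"
  have a_pos: "a t > 0" for t
    using assms by (simp add: a_def Psi_def)
  have smooth_\<alpha>: "smooth_on UNIV \<alpha>"
    using assms by (simp add: Psi_def)
  have inj: "inj h" and smooth: "smooth_on UNIV h" "smooth_on UNIV a"
    using Psi_inj[OF assms] smooth_on_h_fun[OF smooth_\<alpha>]
      smooth_on_mult[OF open_UNIV smooth_\<alpha> smooth_on_cosh] by (simp_all add: h_def a_def)
  have open_h: "open (range h)"
    using injective_into_1d_imp_open_map_UNIV[OF open_UNIV smooth_on_imp_continuous_on[OF smooth(1)] inj]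
    by simp
  then have U: "open U"
    by (simp add: U_def open_Times)

  \<comment> \<open>On time level \<open>h t\<close> the hypersurface is the sphere of radius \<open>a t\<close>.\<close>
  have M_iff: "x \<in> M \<longleftrightarrow> x \<in> U \<and> snd x \<bullet> snd x = (a (inv h (fst x)))\<^sup>2" for x
  proof (cases "x \<in> U")
    case True
    then obtain t where t: "fst x = h t"
      by (auto simp: U_def)
    have "(h t)\<^sup>2 + (\<alpha> t)\<^sup>2 = (a t)\<^sup>2"
      using cosh_square_eq[of t] by (simp add: h_def h_fun_def a_def power_mult_distrib algebra_simps)
    then show ?thesis
      using True t inj by (auto simp: M_def dS_iff f_fun_def h_def[symmetric] U_def)
  qed (auto simp: M_def dS_iff U_def mem_Times_iff)
  have F_\<Phi>: "F (\<Phi> z) = z" for z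
    using inj a_pos[of "fst z"] by (simp add: F_def \<Phi>_def prod_eq_iff)
  have \<Phi>_F: "\<Phi> (F x) = x" if "x \<in> U" for x
  proof -
    obtain t where "fst x = h t"
      using \<open>x \<in> U\<close> by (auto simp: U_def)
    then show ?thesis
      using inj a_pos[of t] by (simp add: F_def \<Phi>_def prod_eq_iff)
  qed
  have F_M: "F x \<in> cylinder" if "x \<in> M" for x
  proof -
    have "norm (snd x) = a (inv h (fst x))"
      using that a_pos[of "inv h (fst x)"] by (simp add: M_iff norm_eq_sqrt_inner)
    then show ?thesis
      using a_pos[of "inv h (fst x)"] by (simp add: F_def cylinder_def)
  qed
  have \<Phi>_cyl: "\<Phi> z \<in> M" if "z \<in> cylinder" for z
  proof -
    have "snd z \<bullet> snd z = 1"
      using that by (auto simp: cylinder_def dot_square_norm)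
    then show ?thesis
      using inj by (auto simp: M_iff U_def \<Phi>_def power2_eq_square)
  qed
  have bij: "bij_betw F M cylinder"
    using F_\<Phi> \<Phi>_F F_M \<Phi>_cyl M_iff by (intro bij_betw_byWitness[where f' = \<Phi>]) blast+
  have inv_F: "inv_into M F z = \<Phi> z" if "z \<in> cylinder" for z
    using that bij F_\<Phi> \<Phi>_cyl by (intro inv_into_f_eq) (auto simp: bij_betw_def)

  have smooth_inv: "smooth_on (range h) (inv h)"
    using smooth_on_inv[OF smooth(1) inj] assms by (simp add: Psi_def h_def)
  have smooth_inv_a: "smooth_on (range h) (\<lambda>s. inverse (a (inv h s)))"
    using a_pos by (intro smooth_on_compose[OF smooth_on_inverse smooth_on_compose[OF smooth(2) smooth_inv]] open_h)
      (auto simp: open_Compl less_le)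
  have smooth_F: "smooth_on U F"
    unfolding F_def using U open_h
    by (intro smooth_on_Pair smooth_on_scaleR smooth_on_compose[OF smooth_inv smooth_on_fst]
        smooth_on_compose[OF smooth_inv_a smooth_on_fst] smooth_on_snd) (auto simp: U_def)
  have smooth_\<Phi>: "smooth_on UNIV \<Phi>"
    unfolding \<Phi>_def
    by (intro smooth_on_Pair smooth_on_scaleR smooth_on_compose[OF smooth(1) smooth_on_fst]
        smooth_on_compose[OF smooth(2) smooth_on_fst] smooth_on_snd) auto
  have diffeo: "diffeomorphism M cylinder F"
    unfolding diffeomorphism_def smooth_map_def
  proof (intro conjI ballI bij)
    show "F ` M \<subseteq> cylinder" "inv_into M F ` cylinder \<subseteq> M"
      using F_M \<Phi>_cyl inv_F by auto
    show "\<exists>V G. open V \<and> p \<in> V \<and> smooth_on V G \<and> (\<forall>x\<in>M \<inter> V. G x = F x)" if "p \<in> M" for p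
      using that U smooth_F M_iff by blast
    show "\<exists>V G. open V \<and> z \<in> V \<and> smooth_on V G \<and> (\<forall>x\<in>cylinder \<inter> V. G x = inv_into M F x)"
      for z :: "real \<times> (real ^ 'm)"
      using smooth_\<Phi> inv_F by (intro exI[of _ UNIV] exI[of _ \<Phi>]) auto
  qed

  have metric: "warped_metric (\<lambda>t. (deriv \<alpha> t)\<^sup>2 - (\<alpha> t)\<^sup>2) a (F p) (differential M F p v) (differential M F p w)
      = minkowski_metric p v w"
    if p: "p \<in> M" and tangent: "v \<in> tangent_space M p" "w \<in> tangent_space M p" for p v w
  proof -
    define F' where "F' = frechet_derivative F (at p)"
    define t u where "t = fst (F p)" and "u = snd (F p)"
    define h' a' where "h' = deriv \<alpha> t * sinh t + \<alpha> t * cosh t"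
      and "a' = deriv \<alpha> t * cosh t + \<alpha> t * sinh t"
    have pU: "p \<in> U"
      using p M_iff by blast
    have F': "(F has_derivative F') (at p)"
      unfolding F'_def using smooth_on_imp_has_derivative[OF smooth_F pU] .
    have h': "(h has_derivative (*) h') (at t)" and a': "(a has_derivative (*) a') (at t)"
      unfolding h_def a_def h'_def a'_def has_field_derivative_def[symmetric]
      by (rule DERIV_h_fun[OF smooth_\<alpha>],
        auto intro!: derivative_eq_intros smooth_on_imp_DERIV[OF smooth_\<alpha>])
    have "((\<lambda>z. h (fst z)) has_derivative (\<lambda>\<xi>. h' * fst \<xi>)) (at (F p))"
      and "((\<lambda>z. a (fst z)) has_derivative (\<lambda>\<xi>. a' * fst \<xi>)) (at (F p))"
      using has_derivative_compose[OF bounded_linear_imp_has_derivative[OF bounded_linear_fst]]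
        h' a' unfolding t_def by blast+
    then have \<Phi>': "(\<Phi> has_derivative (\<lambda>\<xi>. (h' * fst \<xi>, a t *\<^sub>R snd \<xi> + (a' * fst \<xi>) *\<^sub>R u))) (at (F p))"
      unfolding \<Phi>_def t_def u_def
      by (auto intro!: has_derivative_Pair has_derivative_scaleR has_derivative_snd)
    \<comment> \<open>\<open>\<Phi> \<circ> F\<close> is the identity near \<open>p\<close>, so its two derivatives there, by the chain rule and directly, agree.\<close>
    have "((\<lambda>x. \<Phi> (F x)) has_derivative (\<lambda>\<zeta>. \<zeta>)) (at p)"
      by (rule has_derivative_transform_within_open[OF has_derivative_ident U pU]) (simp add: \<Phi>_F)
    from has_derivative_unique[OF this has_derivative_compose[OF F' \<Phi>']]
    have expand: "\<zeta> = (h' * fst (F' \<zeta>), a t *\<^sub>R snd (F' \<zeta>) + (a' * fst (F' \<zeta>)) *\<^sub>R u)" for \<zeta>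
      by metis
    have F_cyl: "F ` M \<subseteq> cylinder"
      using F_M by blast
    have orth: "u \<bullet> snd (F' v) = 0" "u \<bullet> snd (F' w) = 0"
      unfolding u_def using derivative_tangent_to_cylinder[OF F' _ F_cyl] tangent by blast+
    have unit: "u \<bullet> u = 1"
      using F_M[OF p] by (auto simp: u_def cylinder_def dot_square_norm)
    have \<beta>: "a'\<^sup>2 - h'\<^sup>2 = (deriv \<alpha> t)\<^sup>2 - (\<alpha> t)\<^sup>2"
    proof -
      have "a'\<^sup>2 - h'\<^sup>2 = ((deriv \<alpha> t)\<^sup>2 - (\<alpha> t)\<^sup>2) * ((cosh t)\<^sup>2 - (sinh t)\<^sup>2)"
        by (simp add: a'_def h'_def algebra_simps power2_eq_square)
      then show ?thesis
        by (simp add: cosh_square_eq)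
    qed
    have "eta v w = eta (h' * fst (F' v), a t *\<^sub>R snd (F' v) + (a' * fst (F' v)) *\<^sub>R u)
        (h' * fst (F' w), a t *\<^sub>R snd (F' w) + (a' * fst (F' w)) *\<^sub>R u)"
      using expand by metis
    also have "\<dots> = (a'\<^sup>2 - h'\<^sup>2) * (fst (F' v) * fst (F' w)) + (a t)\<^sup>2 * (snd (F' v) \<bullet> snd (F' w))"
      using orth unit by (simp add: eta_eq_inner inner_add_left inner_add_right inner_commute
          power2_eq_square algebra_simps)
    finally show ?thesis
      unfolding differential_eq[OF F' tangent(1)] differential_eq[OF F' tangent(2)]
      by (simp add: minkowski_metric_def warped_metric_def round_metric_def \<beta> t_def)
  qed
  have "isometry M minkowski_metric cylinder (warped_metric (\<lambda>t. (deriv \<alpha> t)\<^sup>2 - (\<alpha> t)\<^sup>2) a) F"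
    unfolding isometry_def using diffeo metric by blast
  then show ?thesis
    unfolding isometric_def M_def h_def a_def by (rule exI[of _ F])
qed

section \<open>Smooth functions flat at the origin\<close>

text \<open>
  The functions \<open>p(1/t) exp(-1/t)\<close>, extended by \<open>0\<close> to \<open>t \<le> 0\<close>. Allowing all polynomials \<open>p\<close> makes
  the family closed under differentiation, which yields smoothness of every member at once.
\<close>

definition flat_exp :: "real poly \<Rightarrow> real \<Rightarrow> real" where
  "flat_exp p t = (if t > 0 then poly p (inverse t) * exp (- inverse t) else 0)"

lemma flat_exp_limit_0:
  fixes p :: "real poly"
  shows "((\<lambda>t. poly p (inverse t) * exp (- inverse t)) \<longlongrightarrow> 0) (at_right 0)"
proof -
  \<comment> \<open>Substituting \<open>x = 1/t\<close>, this is the dominance of \<open>exp\<close> over powers at infinity.\<close>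
  have "((\<lambda>x. poly p x * exp (- x)) \<longlongrightarrow> 0) at_top"
  proof -
    have "((\<lambda>x. \<Sum>i\<le>degree p. coeff p i * (x ^ i / exp x)) \<longlongrightarrow> (\<Sum>i\<le>degree p. coeff p i * 0)) at_top"
      using tendsto_power_div_exp_0 by (intro tendsto_sum tendsto_mult tendsto_const) blast
    then show ?thesis
      by (simp add: poly_altdef sum_distrib_right exp_minus divide_inverse mult.assoc)
  qed
  then show ?thesis
    using filterlim_compose[OF _ filterlim_inverse_at_top_right] by blast
qed

text \<open>
  Away from \<open>0\<close> this is the chain rule for \<open>x = 1/t\<close>, where \<open>dx/dt = - x\<^sup>2\<close>. At \<open>0\<close> the difference
  quotient on the right is again a member of the family, with \<open>p\<close> multiplied by \<open>x\<close>, and hence tends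
  to \<open>0\<close>.
\<close>

lemma DERIV_flat_exp: "(flat_exp p has_real_derivative flat_exp ([:0, 0, 1:] * (p - pderiv p)) t) (at t)"
proof (cases t "0 :: real" rule: linorder_cases)
  case less
  have "((\<lambda>t. 0) has_real_derivative 0) (at t)"
    by simp
  then have "(flat_exp p has_real_derivative 0) (at t)"
    by (rule has_field_derivative_transform_within_open[where S = "{..<0}"])
      (use less in \<open>auto simp: flat_exp_def\<close>)
  then show ?thesis
    using less by (simp add: flat_exp_def)
next
  case greater
  have "((\<lambda>t. poly p (inverse t) * exp (- inverse t)) has_real_derivative
      flat_exp ([:0, 0, 1:] * (p - pderiv p)) t) (at t)"
    using greater
    by (auto intro!: derivative_eq_intros DERIV_chain2[OF poly_DERIV]
        simp: flat_exp_def algebra_simps power2_eq_square)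
  then show ?thesis
    by (rule has_field_derivative_transform_within_open[where S = "{0<..}"])
      (use greater in \<open>auto simp: flat_exp_def\<close>)
next
  case equal
  have "((\<lambda>s. (flat_exp p s - flat_exp p 0) / (s - 0)) \<longlongrightarrow> 0) (at_right 0)"
  proof (rule Lim_transform_eventually[OF flat_exp_limit_0[of "[:0, 1:] * p"]])
    show "\<forall>\<^sub>F s in at_right 0. poly ([:0, 1:] * p) (inverse s) * exp (- inverse s)
        = (flat_exp p s - flat_exp p 0) / (s - 0)"
      by (auto simp: eventually_at_filter flat_exp_def field_simps)
  qed
  moreover have "((\<lambda>s. (flat_exp p s - flat_exp p 0) / (s - 0)) \<longlongrightarrow> 0) (at_left 0)"
    by (rule tendsto_eventually) (auto simp: eventually_at_filter flat_exp_def)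
  ultimately show ?thesis
    by (simp add: equal flat_exp_def has_field_derivative_iff filterlim_split_at)
qed

lemma smooth_on_flat_exp: "smooth_on UNIV (flat_exp p)"
  unfolding smooth_on_def
proof
  fix k
  show "higher_differentiable_on UNIV (flat_exp p) k"
  proof (induction k arbitrary: p)
    case 0
    show ?case
      using DERIV_isCont[OF DERIV_flat_exp] by (simp add: continuous_at_imp_continuous_on)
  next
    case (Suc k)
    show ?case
      by (rule higher_differentiable_on_real_SucI[OF open_UNIV DERIV_flat_exp Suc.IH])
  qed
qed

definition flat_step :: "real \<Rightarrow> real" where
  "flat_step t = (if t > 0 then exp (- inverse t) else 0)"

lemma flat_step_eq: "flat_step = flat_exp 1"
  by (simp add: flat_step_def flat_exp_def fun_eq_iff)

lemma smooth_on_flat_step: "smooth_on UNIV flat_step"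
  by (simp add: flat_step_eq smooth_on_flat_exp)

text \<open>
  For \<open>t = 0\<close> the quotient is \<open>0\<close> by the convention for division, which is the correct derivative.
\<close>

lemma DERIV_flat_step: "(flat_step has_real_derivative flat_step t / t\<^sup>2) (at t)"
proof -
  have "flat_exp ([:0, 0, 1:] * (1 - pderiv 1)) t = flat_step t / t\<^sup>2"
    by (simp add: flat_exp_def flat_step_def pderiv_1 field_simps power2_eq_square)
  then show ?thesis
    using DERIV_flat_exp[of 1 t] by (simp only: flat_step_eq)
qed

section \<open>A function joining hyperbolic secant to one\<close>

text \<open>
  By the mean value theorem applied twice, \<open>cosh t - 1 = t sinh z = t z cosh y\<close> with
  \<open>0 < y < z < t\<close>.
\<close>

lemma cosh_minus_1_le: "cosh t - 1 \<le> t\<^sup>2 * cosh (t::real)" if "t \<ge> 0"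
proof (cases "t = 0")
  case False
  then have t: "t > 0" using that by simp
  have D: "(cosh has_real_derivative sinh x) (at x)" "(sinh has_real_derivative cosh x) (at x)" for x :: real
    by (auto intro!: derivative_eq_intros)
  obtain z where z: "0 < z" "z < t" "cosh t - cosh 0 = (t - 0) * sinh z"
    using MVT2[OF t, of cosh sinh] D(1) by blast
  obtain y where y: "0 < y" "y < z" "sinh z - sinh 0 = (z - 0) * cosh y"
    using MVT2[OF z(1), of sinh cosh] D(2) by blast
  have "cosh y \<le> cosh t"
    using y z by (simp add: cosh_real_nonneg_le_iff)
  then have "z * cosh y \<le> t * cosh t"
    using y z by (intro mult_mono) auto
  then show ?thesis
    using y z by (simp add: power2_eq_square)
qed simp

text \<open>
  The convex combination, with weight \<^const>\<open>flat_step\<close>, of the constant \<open>1\<close> of de Sitter space and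
  of the function \<open>1 / cosh\<close> for which the sphere radius is constant.
\<close>

definition sech_to_one :: "real \<Rightarrow> real" where
  "sech_to_one t = flat_step t + (1 - flat_step t) * inverse (cosh t)"

definition sech_to_one' :: "real \<Rightarrow> real" where
  "sech_to_one' t = flat_step t / t\<^sup>2 * (1 - inverse (cosh t)) - (1 - flat_step t) * sinh t / (cosh t)\<^sup>2"

lemma smooth_on_sech_to_one: "smooth_on UNIV sech_to_one"
proof -
  have "smooth_on UNIV (\<lambda>t::real. inverse (cosh t))"
    by (rule smooth_on_compose[OF smooth_on_inverse smooth_on_cosh]) (auto simp: open_Compl)
  then show ?thesis
    unfolding sech_to_one_def[abs_def]
    by (intro smooth_on_mult smooth_on_add smooth_on_diff smooth_on_const smooth_on_flat_step
        smooth_on_cosh open_UNIV)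
qed

lemma DERIV_sech_to_one:
  "(sech_to_one has_real_derivative sech_to_one' t) (at t)"
  unfolding sech_to_one_def[abs_def] sech_to_one'_def
  by (rule derivative_eq_intros DERIV_flat_step refl | simp)+
    (simp add: divide_simps power2_eq_square, simp add: algebra_simps)

lemma flat_step_bounds: "0 \<le> flat_step t" "flat_step t \<le> 1"
  by (auto simp: flat_step_def)

text \<open>
  Write \<open>w\<close> for the weight and \<open>d = w' (cosh t - 1)\<close>. Multiplied by \<open>cosh\<^sup>2 t\<close>, the claim becomes
  \<open>|d cosh t - (1 - w) sinh t| < w cosh\<^sup>2 t + (1 - w) cosh t\<close>. Here \<open>0 \<le> d \<le> w cosh t\<close> by the bound on
  \<open>cosh t - 1\<close>, and \<open>|sinh t| < cosh t\<close> handles the remaining terms.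
\<close>

lemma abs_deriv_sech_to_one_less: "\<bar>sech_to_one' t\<bar> < sech_to_one t"
proof -
  let ?c = "cosh t" and ?s = "sinh t" and ?w = "flat_step t"
  have c: "?c \<ge> 1" "\<bar>?s\<bar> < ?c"
    by (rule cosh_real_ge_1 abs_sinh_less_cosh)+
  have w: "0 \<le> ?w" "?w \<le> 1"
    by (rule flat_step_bounds)+
  define d where "d = ?w / t\<^sup>2 * (?c - 1)"
  have d: "0 \<le> d" "d \<le> ?w * ?c"
  proof -
    show "0 \<le> d"
      using w c by (simp add: d_def)
    show "d \<le> ?w * ?c"
    proof (cases "t > 0")
      case True
      then have "(?c - 1) / t\<^sup>2 \<le> ?c"
        using cosh_minus_1_le[of t] by (simp add: field_simps)
      then show ?thesis
        using mult_left_mono[OF _ w(1)] by (fastforce simp: d_def)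
    qed (simp add: d_def flat_step_def)
  qed
  have scaled_deriv: "sech_to_one' t * ?c\<^sup>2 = d * ?c - (1 - ?w) * ?s"
  proof -
    have "sech_to_one' t = d / ?c - (1 - ?w) * ?s / ?c\<^sup>2"
      using c by (simp add: sech_to_one'_def d_def right_diff_distrib left_diff_distrib divide_inverse)
    then show ?thesis
      using c by (simp add: left_diff_distrib power2_eq_square) (simp add: field_simps)
  qed
  have scaled: "sech_to_one t * ?c\<^sup>2 = (1 - ?w) * ?c + ?w * ?c * ?c"
    by (simp add: sech_to_one_def field_simps power2_eq_square)
  have dc: "0 \<le> d * ?c" "d * ?c \<le> ?w * ?c * ?c"
    using d c by (auto intro: mult_right_mono)
  have "\<bar>d * ?c - (1 - ?w) * ?s\<bar> < (1 - ?w) * ?c + ?w * ?c * ?c"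
  proof (cases "t > 0")
    case True
    have "?w < 1" "?w > 0" "?s > 0"
      using True by (simp_all add: flat_step_def)
    then have "\<bar>(1 - ?w) * ?s\<bar> < (1 - ?w) * ?c" "?w * ?c * ?c > 0"
      using c by (simp_all add: abs_mult)
    then show ?thesis
      using dc unfolding abs_less_iff by linarith
  next
    case False
    then show ?thesis
      using c by (simp add: flat_step_def d_def)
  qed
  then have "\<bar>sech_to_one' t\<bar> * ?c\<^sup>2 < sech_to_one t * ?c\<^sup>2"
    unfolding scaled by (simp flip: scaled_deriv add: abs_mult)
  then show ?thesis
    using c by simp
qed

text \<open>
  The radius of the sphere at parameter \<open>t\<close>, in the form in which its behaviour can be read off.
\<close>

lemma sech_to_one_times_cosh: "sech_to_one t * cosh t = 1 + flat_step t * (cosh t - 1)"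
  by (simp add: sech_to_one_def algebra_simps)

lemma strict_mono_on_radius: "strict_mono_on {0<..} (\<lambda>t. 1 + flat_step t * (cosh t - 1))"
proof (rule strict_mono_onI)
  fix s t :: real
  assume st: "s \<in> {0<..}" "t \<in> {0<..}" "s < t"
  then have "flat_step s < flat_step t" "cosh s < cosh t"
    by (auto simp: flat_step_def cosh_real_nonneg_less_iff)
  then show "1 + flat_step s * (cosh s - 1) < 1 + flat_step t * (cosh t - 1)"
    using st cosh_real_ge_1[of s] flat_step_bounds[of s]
    by (intro add_strict_left_mono mult_strict_mono) (auto simp: flat_step_def)
qed

lemma radius_at_top: "filterlim (\<lambda>t. 1 + flat_step t * (cosh t - 1)) at_top at_top"
proof -
  have "filterlim (\<lambda>t::real. 1 + exp (- inverse t) * (cosh t - 1)) at_top at_top"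
    by real_asymp
  then show ?thesis
    by (rule filterlim_mono_eventually)
      (auto simp: flat_step_def intro: eventually_mono[OF eventually_gt_at_top[of 0]])
qed

lemma sech_to_one_limit:
  "(sech_to_one \<longlongrightarrow> 1) at_top" "(sech_to_one' \<longlongrightarrow> 0) at_top"
proof -
  have "((\<lambda>t::real. exp (- inverse t) + (1 - exp (- inverse t)) * inverse (cosh t)) \<longlongrightarrow> 1) at_top"
    by real_asymp
  then show "(sech_to_one \<longlongrightarrow> 1) at_top"
    by (rule Lim_transform_eventually)
      (auto simp: sech_to_one_def flat_step_def intro: eventually_mono[OF eventually_gt_at_top[of 0]])
  have "((\<lambda>t::real. exp (- inverse t) / t\<^sup>2 * (1 - inverse (cosh t)) - (1 - exp (- inverse t)) * sinh t / (cosh t)\<^sup>2) \<longlongrightarrow> 0) at_top"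
    by real_asymp
  then show "(sech_to_one' \<longlongrightarrow> 0) at_top"
    by (rule Lim_transform_eventually)
      (auto simp: sech_to_one'_def flat_step_def intro: eventually_mono[OF eventually_gt_at_top[of 0]])
qed

theorem proposition3p15:
  fixes n :: nat
  assumes "n \<ge> 1" and "CARD('m::finite) = n + 1"
  shows "\<exists>\<alpha>\<in>Psi_hat. \<exists>a \<beta> :: real \<Rightarrow> real.
     isometric (dS (range (h_fun \<alpha>)) (f_fun \<alpha>) :: (real \<times> (real ^ 'm)) set) minkowski_metric
               (cylinder :: (real \<times> (real ^ 'm)) set) (warped_metric \<beta> a) \<and>
     smooth_on UNIV a \<and> smooth_on UNIV \<beta> \<and>
     (\<exists>c>0. \<forall>t\<le>0. a t = c) \<and> strict_mono_on {0<..} a \<and>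
     filterlim a at_top at_top \<and>
     (\<forall>t. \<beta> t < 0) \<and>
     (\<beta> \<longlongrightarrow> -1) at_top"
proof -
  let ?\<alpha> = sech_to_one
  define a where "a = (\<lambda>t. ?\<alpha> t * cosh t)"
  define \<beta> where "\<beta> = (\<lambda>t. (deriv ?\<alpha> t)\<^sup>2 - (?\<alpha> t)\<^sup>2)"
  have deriv: "deriv ?\<alpha> t = sech_to_one' t" for t
    using DERIV_sech_to_one by (rule DERIV_imp_deriv)
  have small: "\<bar>deriv ?\<alpha> t\<bar> < ?\<alpha> t" for t
    unfolding deriv by (rule abs_deriv_sech_to_one_less)
  have mem: "?\<alpha> \<in> Psi_hat"
    using smooth_on_sech_to_one small by (rule Psi_hatI)
  have a: "a = (\<lambda>t. 1 + flat_step t * (cosh t - 1))"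
    by (simp add: a_def sech_to_one_times_cosh)
  have isometric: "isometric (dS (range (h_fun ?\<alpha>)) (f_fun ?\<alpha>) :: (real \<times> (real ^ 'm)) set) minkowski_metric
      (cylinder :: (real \<times> (real ^ 'm)) set) (warped_metric \<beta> a)"
    unfolding \<beta>_def a_def using mem by (intro dS_isometric_warped_cylinder) (simp add: Psi_hat_def)
  have "smooth_on UNIV a"
    unfolding a_def by (intro smooth_on_mult smooth_on_sech_to_one smooth_on_cosh open_UNIV)
  moreover have "smooth_on UNIV \<beta>"
    unfolding \<beta>_def power2_eq_square
    by (intro smooth_on_diff smooth_on_mult smooth_on_deriv smooth_on_sech_to_one open_UNIV)
  moreover have "\<exists>c>0. \<forall>t\<le>0. a t = c"
    by (intro exI[of _ 1]) (simp add: a flat_step_def)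
  moreover have "strict_mono_on {0<..} a" "filterlim a at_top at_top"
    unfolding a by (rule strict_mono_on_radius radius_at_top)+
  moreover have "\<beta> t < 0" for t
    using power_strict_mono[OF small[of t], of 2] by (simp add: \<beta>_def)
  moreover have "(\<beta> \<longlongrightarrow> -1) at_top"
    using tendsto_diff[OF tendsto_power[OF sech_to_one_limit(2), of 2] tendsto_power[OF sech_to_one_limit(1), of 2]]
    by (simp add: \<beta>_def deriv)
  ultimately show ?thesis
    using mem isometric by blast
qed

end
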